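(* Let $\mathbb{X}$ be a real Banach space. Then $x \in \mathbb{X}$ is a symmetric point in $\mathbb{X}$ if and only if for every $u \in \mathbb{X}$ the following four conditions hold: (i) $u \in x^{-}$ implies that $x \in u^{-}$; (ii) $u \in x^{+}$ implies that $x \in u^{+}$; (iii) $x \in u^{-}$ implies that $u \in x^{-}$; (iv) $x \in u^{+}$ implies that $u \in x^{+}$.
   Context: For $x,y$ in a real Banach space $\mathbb{X}$, $x$ is Birkhoff-James orthogonal to $y$, written $x \perp_B y$, if $\|x+\lambda y\| \geq \|x\|$ for all $\lambda \in \mathbb{R}$. An element $x \in \mathbb{X}$ is a left-symmetric point in $\mathbb{X}$ if for every $y \in \mathbb{X}$, $x \perp_B y$ implies $y \perp_B x$; it is a right-symmetric point in $\mathbb{X}$ if for every $y \in \mathbb{X}$, $y \perp_B x$ implies $x \perp_B y$; it is a symmetric point in $\mathbb{X}$ if it is both left-symmetric and right-symmetric. For $x \in \mathbb{X}$, define $x^{+} = \{y \in \mathbb{X} : \|x+\lambda y\| \geq \|x\| \text{ for all } \lambda \geq 0\}$ and $x^{-} = \{y \in \mathbb{X} : \|x+\lambda y\| \geq \|x\| \text{ for all } \lambda \leq 0\}$. *)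

theory Defs
  imports "HOL-Analysis.Analysis"
begin

definition BJ_orthogonal :: "'a::real_normed_vector \<Rightarrow> 'a \<Rightarrow> bool"  (infix "\<bottom>\<^sub>B" 50)
  where "x \<bottom>\<^sub>B y \<longleftrightarrow> (\<forall>l::real. norm (x + l *\<^sub>R y) \<ge> norm x)"

definition left_symmetric_point :: "'a::real_normed_vector \<Rightarrow> bool"
  where "left_symmetric_point x \<longleftrightarrow> (\<forall>y. x \<bottom>\<^sub>B y \<longrightarrow> y \<bottom>\<^sub>B x)"

definition right_symmetric_point :: "'a::real_normed_vector \<Rightarrow> bool"
  where "right_symmetric_point x \<longleftrightarrow> (\<forall>y. y \<bottom>\<^sub>B x \<longrightarrow> x \<bottom>\<^sub>B y)"

definition symmetric_point :: "'a::real_normed_vector \<Rightarrow> bool"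
  where "symmetric_point x \<longleftrightarrow> left_symmetric_point x \<and> right_symmetric_point x"

definition BJ_plus :: "'a::real_normed_vector \<Rightarrow> 'a set"
  where "BJ_plus x = {y. \<forall>l::real. l \<ge> 0 \<longrightarrow> norm (x + l *\<^sub>R y) \<ge> norm x}"

definition BJ_minus :: "'a::real_normed_vector \<Rightarrow> 'a set"
  where "BJ_minus x = {y. \<forall>l::real. l \<le> 0 \<longrightarrow> norm (x + l *\<^sub>R y) \<ge> norm x}"

end

theory Submission
  imports Defs
begin

text \<open>By the symmetries \<open>u \<mapsto> - u\<close> and \<open>x \<mapsto> - x\<close> only (ii) and (iv) need an argument, for
  nonzero \<open>x\<close>. For (ii), if \<open>x \<notin> u\<^sup>+\<close>, then a minimiser \<open>a\<close> of \<open>t \<mapsto> \<parallel>u + t x\<parallel>\<close> is positive and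
  \<open>u + a x\<close> is orthogonal to \<open>x\<close>; right symmetry gives \<open>x \<bottom> u + a x\<close>, which forces \<open>u \<in> x\<^sup>-\<close>, so
  \<open>x \<bottom> u\<close> and hence \<open>u \<bottom> x\<close>. For (iv), if \<open>u \<notin> x\<^sup>+\<close>, then the right derivative of the norm at \<open>x\<close>
  in direction \<open>u\<close> is negative, which yields \<open>a > 0\<close> with \<open>x \<bottom> u + a x\<close>; left symmetry gives
  \<open>u + a x \<bottom> x\<close>, and since \<open>x \<in> u\<^sup>+\<close> the value at \<open>0\<close> is also minimal, so \<open>u \<bottom> x\<close> and
  \<open>x \<bottom> u\<close>.\<close>

lemma BJ_orthogonal_iff: "x \<bottom>\<^sub>B y \<longleftrightarrow> y \<in> BJ_plus x \<and> y \<in> BJ_minus x"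
  unfolding BJ_orthogonal_def BJ_plus_def BJ_minus_def mem_Collect_eq by (meson linear)

lemma BJ_minus_iff_uminus_right: "y \<in> BJ_minus x \<longleftrightarrow> - y \<in> BJ_plus x"
proof -
  have "(\<forall>l\<le>0. P l) \<longleftrightarrow> (\<forall>l\<ge>0. P (- l))" for P :: "real \<Rightarrow> bool"
    by (metis add.inverse_inverse neg_0_le_iff_le neg_le_0_iff_le)
  then show ?thesis
    unfolding BJ_plus_def BJ_minus_def by simp
qed

lemma BJ_minus_iff_uminus_left: "y \<in> BJ_minus x \<longleftrightarrow> y \<in> BJ_plus (- x)"
proof -
  have "norm (x + l *\<^sub>R (- y)) = norm (- x + l *\<^sub>R y)" for l
    by (metis add.inverse_inverse minus_add_distrib norm_minus_cancel scaleR_minus_right)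
  then show ?thesis
    unfolding BJ_minus_iff_uminus_right BJ_plus_def by simp
qed

text \<open>\<open>x\<close> is the convex combination of \<open>x - m *\<^sub>R u\<close> and
  \<open>x + l *\<^sub>R u\<close> with weights proportional to \<open>l\<close> and
  \<open>m\<close>; multiplying by \<open>l + m\<close> avoids the division.\<close>

lemma norm_on_line_convex:
  fixes x u :: "'a::real_normed_vector"
  assumes "l \<ge> 0" "m \<ge> 0"
  shows "(l + m) * norm x \<le> l * norm (x - m *\<^sub>R u) + m * norm (x + l *\<^sub>R u)"
proof -
  have "(l + m) *\<^sub>R x = l *\<^sub>R (x - m *\<^sub>R u) + m *\<^sub>R (x + l *\<^sub>R u)"
    by (simp add: algebra_simps)
  then have "norm ((l + m) *\<^sub>R x) \<le> norm (l *\<^sub>R (x - m *\<^sub>R u)) + norm (m *\<^sub>R (x + l *\<^sub>R u))"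
    by (metis norm_triangle_ineq)
  then show ?thesis using assms by simp
qed

text \<open>A convex function of a real variable that drops below its value at 0 on the right cannot
  also do so on the left.\<close>

lemma in_BJ_minus_of_not_BJ_plus:
  assumes "y \<notin> BJ_plus x"
  shows "y \<in> BJ_minus x"
proof -
  obtain l where l: "l \<ge> 0" "norm (x + l *\<^sub>R y) < norm x"
    using assms unfolding BJ_plus_def by (auto simp: not_le)
  then have "l > 0" by (cases "l = 0") auto
  have "norm (x - m *\<^sub>R y) \<ge> norm x" if "m \<ge> 0" for m
  proof -
    have "(l + m) * norm x \<le> l * norm (x - m *\<^sub>R y) + m * norm (x + l *\<^sub>R y)"
      using norm_on_line_convex \<open>l \<ge> 0\<close> that .
    also have "m * norm (x + l *\<^sub>R y) \<le> m * norm x"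
      using l that by (intro mult_left_mono) auto
    finally have "l * norm x \<le> l * norm (x - m *\<^sub>R y)" by (simp add: algebra_simps)
    then show ?thesis using \<open>l > 0\<close> by simp
  qed
  then show ?thesis
    unfolding BJ_minus_iff_uminus_right BJ_plus_def by simp
qed

lemma BJ_orthogonal_left_exists:
  fixes x u :: "'a::real_normed_vector"
  assumes "x \<noteq> 0"
  shows "\<exists>a. u + a *\<^sub>R x \<bottom>\<^sub>B x"
proof -
  \<comment> \<open>For \<open>\<bar>t\<bar> > M\<close> the norm of
    \<open>u + t *\<^sub>R x\<close> exceeds \<open>norm u\<close>, its value at
    \<open>t = 0\<close>, so a minimiser on the compact interval is a global one.\<close>
  define M where "M = 2 * norm u / norm x"
  have "M \<ge> 0" by (simp add: M_def)
  have "continuous_on {-M..M} (\<lambda>t. norm (u + t *\<^sub>R x))"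
    by (intro continuous_intros)
  then obtain a where a: "\<forall>t\<in>{-M..M}. norm (u + a *\<^sub>R x) \<le> norm (u + t *\<^sub>R x)"
    using continuous_attains_inf[of "{-M..M}"] \<open>M \<ge> 0\<close> by force
  have "norm (u + a *\<^sub>R x) \<le> norm (u + t *\<^sub>R x)" for t
  proof (cases "\<bar>t\<bar> \<le> M")
    case True
    then show ?thesis using a by (simp add: abs_le_iff)
  next
    case False
    then have "2 * norm u < \<bar>t\<bar> * norm x"
      using assms by (simp add: M_def field_simps)
    moreover have "norm (u + t *\<^sub>R x) \<ge> norm (t *\<^sub>R x) - norm u"
      using norm_diff_ineq[of "t *\<^sub>R x" u] by (simp add: add.commute)
    moreover have "norm (u + a *\<^sub>R x) \<le> norm u"
      using a \<open>M \<ge> 0\<close> by (metis add.right_neutral atLeastAtMost_iff neg_le_0_iff_le scaleR_zero_left)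
    ultimately show ?thesis by simp
  qed
  then have "norm (u + a *\<^sub>R x) \<le> norm (u + a *\<^sub>R x + l *\<^sub>R x)" for l
    by (metis add.assoc scaleR_add_left)
  then show ?thesis unfolding BJ_orthogonal_def by blast
qed

lemma BJ_orthogonal_right_exists_pos:
  fixes x u :: "'a::real_normed_vector"
  assumes "x \<noteq> 0" and "u \<notin> BJ_plus x"
  shows "\<exists>a>0. x \<bottom>\<^sub>B u + a *\<^sub>R x"
proof -
  define q where "q l = (norm (x + l *\<^sub>R u) - norm x) / l" for l
  \<comment> \<open>By convexity the infimum is the right derivative of the norm at \<open>x\<close> in direction \<open>u\<close>.\<close>
  define d where "d = (INF l\<in>{0<..}. q l)"
  have q_lower: "- norm u \<le> q l" if "l > 0" for l
  proof -
    have "norm x - norm (l *\<^sub>R u) \<le> norm (x + l *\<^sub>R u)" by (rule norm_diff_ineq)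
    then show ?thesis using that by (simp add: q_def field_simps)
  qed
  then have bdd: "bdd_below (q ` {0<..})" by (intro bdd_belowI2) auto
  have d_le: "d \<le> q l" if "l > 0" for l
    unfolding d_def using bdd that by (intro cINF_lower) auto
  have supporting: "norm x + l * d \<le> norm (x + l *\<^sub>R u)" for l
  proof (cases l "0::real" rule: linorder_cases)
    case greater
    then show ?thesis using d_le[OF greater] by (simp add: q_def field_simps)
  next
    case less
    \<comment> \<open>Convexity puts every left difference quotient below every right one, hence
      below their infimum \<open>d\<close>.\<close>
    have "(norm (x + l *\<^sub>R u) - norm x) / l \<le> q r" if "r > 0" for r
    proof -
      have "(r + - l) * norm x \<le> r * norm (x + l *\<^sub>R u) + - l * norm (x + r *\<^sub>R u)"
        using norm_on_line_convex[of r "- l" x u] that less by simp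
      then show ?thesis using that less by (simp add: q_def field_simps)
    qed
    then have "(norm (x + l *\<^sub>R u) - norm x) / l \<le> d"
      unfolding d_def by (intro cINF_greatest) auto
    then show ?thesis using less by (simp add: field_simps)
  qed simp
  obtain l where l: "l \<ge> 0" "norm (x + l *\<^sub>R u) < norm x"
    using assms unfolding BJ_plus_def by (auto simp: not_le)
  then have "l * d < 0" using supporting[of l] by simp
  then have "d < 0" using l by (simp add: mult_less_0_iff)
  \<comment> \<open>This solves \<open>d + a * norm x = 0\<close>: the linear form on the span with
    value \<open>norm x\<close> at \<open>x\<close> and \<open>d\<close> at \<open>u\<close> then
    vanishes at \<open>u + a *\<^sub>R x\<close>.\<close>
  define a where "a = - d / norm x"
  have "a > 0" using \<open>d < 0\<close> \<open>x \<noteq> 0\<close> by (simp add: a_def divide_neg_pos)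
  have "norm x \<le> norm (x + l *\<^sub>R (u + a *\<^sub>R x))" for l
  proof -
    define s where "s = 1 + l * a"
    \<comment> \<open>A positive coefficient \<open>S\<close> of \<open>x\<close> permits rescaling in \<open>supporting\<close>; the coefficient
      \<open>s\<close> may be negative.\<close>
    define S where "S = \<bar>s\<bar> + 1"
    have "S > 0" "S - s \<ge> 0" by (auto simp: S_def)
    have "S * (norm x + l / S * d) \<le> S * norm (x + (l / S) *\<^sub>R u)"
      using supporting[of "l / S"] \<open>S > 0\<close> by (intro mult_left_mono) auto
    also have "\<dots> = norm (S *\<^sub>R (x + (l / S) *\<^sub>R u))" using \<open>S > 0\<close> by simp
    \<comment> \<open>Removing the surplus multiple of \<open>x\<close> costs at most
      \<open>(S - s) * norm x\<close>, which is exactly the surplus on the left-hand side.\<close>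
    also have "S *\<^sub>R (x + (l / S) *\<^sub>R u) = (s *\<^sub>R x + l *\<^sub>R u) + (S - s) *\<^sub>R x"
      using \<open>S > 0\<close> by (simp add: algebra_simps)
    also have "norm \<dots> \<le> norm (s *\<^sub>R x + l *\<^sub>R u) + norm ((S - s) *\<^sub>R x)"
      by (rule norm_triangle_ineq)
    also have "norm ((S - s) *\<^sub>R x) = (S - s) * norm x" using \<open>S - s \<ge> 0\<close> by simp
    finally have "s * norm x + l * d \<le> norm (s *\<^sub>R x + l *\<^sub>R u)"
      using \<open>S > 0\<close> by (simp add: algebra_simps)
    moreover have "s * norm x + l * d = norm x"
      using \<open>x \<noteq> 0\<close> by (simp add: s_def a_def field_simps)
    moreover have "s *\<^sub>R x + l *\<^sub>R u = x + l *\<^sub>R (u + a *\<^sub>R x)"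
      by (simp add: s_def algebra_simps)
    ultimately show ?thesis by simp
  qed
  then show ?thesis using \<open>a > 0\<close> unfolding BJ_orthogonal_def by blast
qed

lemma symmetric_point_BJ_plus:
  assumes "symmetric_point x" and "u \<in> BJ_plus x"
  shows "x \<in> BJ_plus u"
proof (rule ccontr)
  assume not_plus: "x \<notin> BJ_plus u"
  then have "x \<noteq> 0" by (auto simp: BJ_plus_def)
  then obtain a where a: "u + a *\<^sub>R x \<bottom>\<^sub>B x"
    using BJ_orthogonal_left_exists by blast
  have minimal: "norm (u + a *\<^sub>R x) \<le> norm (u + t *\<^sub>R x)" for t
  proof -
    have "norm (u + a *\<^sub>R x) \<le> norm (u + a *\<^sub>R x + (t - a) *\<^sub>R x)"
      using a unfolding BJ_orthogonal_def by blast
    then show ?thesis by (simp add: algebra_simps)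
  qed
  have "a > 0"
  proof (rule ccontr)
    \<comment> \<open>Otherwise \<open>x \<in> BJ_minus u\<close> makes 0 a minimiser too, which
      puts \<open>x\<close> in \<open>BJ_plus u\<close>.\<close>
    assume "\<not> a > 0"
    moreover have "x \<in> BJ_minus u"
      using not_plus by (rule in_BJ_minus_of_not_BJ_plus)
    ultimately have "norm u \<le> norm (u + a *\<^sub>R x)"
      unfolding BJ_minus_def by simp
    then have "x \<in> BJ_plus u"
      unfolding BJ_plus_def using minimal order_trans by blast
    with not_plus show False ..
  qed
  have orth: "x \<bottom>\<^sub>B u + a *\<^sub>R x"
    using a assms(1) by (simp add: symmetric_point_def right_symmetric_point_def)
  have "norm x \<le> norm (x - m *\<^sub>R u)" if "m \<ge> 0" for m
  proof -
    \<comment> \<open>Chosen so that \<open>x - m *\<^sub>R u = c *\<^sub>R x - m *\<^sub>R (u + a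
      *\<^sub>R x)\<close>; orthogonality bounds the norm of the right-hand side below by
      \<open>c * norm x\<close>.\<close>
    define c where "c = 1 + m * a"
    have "c \<ge> 1" using that \<open>a > 0\<close> by (simp add: c_def)
    have "norm x \<le> norm (x + (- m / c) *\<^sub>R (u + a *\<^sub>R x))"
      using orth unfolding BJ_orthogonal_def by blast
    then have "c * norm x \<le> c * norm (x + (- m / c) *\<^sub>R (u + a *\<^sub>R x))"
      using \<open>c \<ge> 1\<close> by simp
    also have "\<dots> = norm (c *\<^sub>R (x + (- m / c) *\<^sub>R (u + a *\<^sub>R x)))"
      using \<open>c \<ge> 1\<close> by simp
    also have "c *\<^sub>R (x + (- m / c) *\<^sub>R (u + a *\<^sub>R x)) = c *\<^sub>R x - m *\<^sub>R (u + a *\<^sub>R x)"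
      using \<open>c \<ge> 1\<close> by (simp add: scaleR_right_diff_distrib[of c x])
    also have "\<dots> = x - m *\<^sub>R u"
      by (simp add: c_def algebra_simps)
    finally have "c * norm x \<le> norm (x - m *\<^sub>R u)" .
    moreover have "norm x \<le> c * norm x"
      using \<open>c \<ge> 1\<close> by (simp add: mult_le_cancel_right1)
    ultimately show ?thesis by simp
  qed
  then have "u \<in> BJ_minus x"
    unfolding BJ_minus_iff_uminus_right BJ_plus_def by simp
  then have "x \<bottom>\<^sub>B u" using assms(2) by (simp add: BJ_orthogonal_iff)
  then have "u \<bottom>\<^sub>B x"
    using assms(1) by (simp add: symmetric_point_def left_symmetric_point_def)
  then show False using not_plus by (simp add: BJ_orthogonal_iff)
qed

lemma symmetric_point_BJ_plus_converse:
  assumes "symmetric_point x" and "x \<in> BJ_plus u"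
  shows "u \<in> BJ_plus x"
proof (rule ccontr)
  assume not_plus: "u \<notin> BJ_plus x"
  then have "x \<noteq> 0" by (auto simp: BJ_plus_def)
  then obtain a where "a > 0" and "x \<bottom>\<^sub>B u + a *\<^sub>R x"
    using BJ_orthogonal_right_exists_pos not_plus by blast
  then have orth: "u + a *\<^sub>R x \<bottom>\<^sub>B x"
    using assms(1) by (simp add: symmetric_point_def left_symmetric_point_def)
  have "norm u \<le> norm (u + t *\<^sub>R x)" for t
  proof -
    have "norm u \<le> norm (u + a *\<^sub>R x)"
      using assms(2) \<open>a > 0\<close> by (simp add: BJ_plus_def)
    also have "\<dots> \<le> norm (u + a *\<^sub>R x + (t - a) *\<^sub>R x)"
      using orth unfolding BJ_orthogonal_def by blast
    finally show ?thesis by (simp add: algebra_simps)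
  qed
  then have "u \<bottom>\<^sub>B x" by (simp add: BJ_orthogonal_def)
  then have "x \<bottom>\<^sub>B u"
    using assms(1) by (simp add: symmetric_point_def right_symmetric_point_def)
  then show False using not_plus by (simp add: BJ_orthogonal_iff)
qed

theorem theorem2p3:
  fixes x :: "'a::banach"
  shows "symmetric_point x \<longleftrightarrow>
    (\<forall>u::'a.
      (u \<in> BJ_minus x \<longrightarrow> x \<in> BJ_minus u) \<and>
      (u \<in> BJ_plus x \<longrightarrow> x \<in> BJ_plus u) \<and>
      (x \<in> BJ_minus u \<longrightarrow> u \<in> BJ_minus x) \<and>
      (x \<in> BJ_plus u \<longrightarrow> u \<in> BJ_plus x))"
proof
  assume sym: "symmetric_point x"
  have plus: "u \<in> BJ_plus x \<longleftrightarrow> x \<in> BJ_plus u" for u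
    using symmetric_point_BJ_plus symmetric_point_BJ_plus_converse sym by blast
  \<comment> \<open>Both sides turn into statements about \<open>BJ_plus\<close> for
    \<open>- u\<close> and \<open>x\<close>.\<close>
  have "u \<in> BJ_minus x \<longleftrightarrow> x \<in> BJ_minus u" for u
    using plus[of "- u"]
    by (simp only: BJ_minus_iff_uminus_right[of u x] BJ_minus_iff_uminus_left[of x u])
  with plus show "\<forall>u::'a.
      (u \<in> BJ_minus x \<longrightarrow> x \<in> BJ_minus u) \<and>
      (u \<in> BJ_plus x \<longrightarrow> x \<in> BJ_plus u) \<and>
      (x \<in> BJ_minus u \<longrightarrow> u \<in> BJ_minus x) \<and>
      (x \<in> BJ_plus u \<longrightarrow> u \<in> BJ_plus x)"
    by blast
next
  assume "\<forall>u::'a.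
      (u \<in> BJ_minus x \<longrightarrow> x \<in> BJ_minus u) \<and>
      (u \<in> BJ_plus x \<longrightarrow> x \<in> BJ_plus u) \<and>
      (x \<in> BJ_minus u \<longrightarrow> u \<in> BJ_minus x) \<and>
      (x \<in> BJ_plus u \<longrightarrow> u \<in> BJ_plus x)"
  \<comment> \<open>Conditions (i) and (ii) together give left symmetry, (iii) and (iv) right
    symmetry.\<close>
  then show "symmetric_point x"
    by (auto simp: symmetric_point_def left_symmetric_point_def right_symmetric_point_def
        BJ_orthogonal_iff)
qed

end
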